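(* Let $\beta>1$ be a real number. If $T_{-\beta}^k(\ell_\beta) = 0$ for some integer $k \ge 1$, or if $\beta$ is the root of a polynomial $p(x) \in \mathbb{Z}[x]$ with $|p(-1)|=1$, then $\beta$ does not possess Property ($-$F).
   Context: For a real number $\beta>1$, set $\ell_\beta = \frac{-\beta}{\beta+1}$ and define the $(-\beta)$-transformation $T_{-\beta}: [\ell_\beta,\ell_\beta+1)\to[\ell_\beta,\ell_\beta+1)$ by $T_{-\beta}(x) = -\beta x - \lfloor -\beta x-\ell_\beta\rfloor$. For $x\in[\ell_\beta,\ell_\beta+1)$ let $d_{-\beta}(x)=x_1x_2x_3\cdots$ with $x_i = \lfloor -\beta T_{-\beta}^{i-1}(x)-\ell_\beta\rfloor\in\{0,1,\dots,\lfloor\beta\rfloor\}$, so that $x=\sum_{i\ge1} x_i(-\beta)^{-i}$. For $x\in\mathbb{R}$, let $k\ge 0$ be the minimal integer with $\frac{x}{(-\beta)^k}\in(\ell_\beta,\ell_\beta+1)$ and let $d_{-\beta}(\frac{x}{(-\beta)^k})=x_1x_2x_3\cdots$; the $(-\beta)$-expansion of $x$ is $x_1\cdots x_k\bullet x_{k+1}x_{k+2}\cdots$ if $k\ge1$ and $0\bullet x_1x_2\cdots$ if $k=0$. It is finite if only finitely many digits are nonzero, i.e. if $T_{-\beta}^n(\frac{x}{(-\beta)^k})=0$ for some $n\ge0$. The number $\beta$ has Property ($-$F) if each element of $\mathbb{Z}[\beta^{-1}]$ has a finite $(-\beta)$-expansion. *)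

theory Defs
  imports Complex_Main "HOL-Computational_Algebra.Polynomial"
begin

definition ell :: "real \<Rightarrow> real" where
  "ell \<beta> = - \<beta> / (\<beta> + 1)"

text \<open>The \<open>(-\<beta>)\<close>-transformation is a self-map of \<open>{ell \<beta>..<ell \<beta> + 1}\<close>; it and the digits below
  are given by total functions, but they are only evaluated at points of that interval.\<close>

definition negbeta_T :: "real \<Rightarrow> real \<Rightarrow> real" where
  "negbeta_T \<beta> x = - \<beta> * x - of_int \<lfloor>- \<beta> * x - ell \<beta>\<rfloor>"

text \<open>Digit sequences are indexed from 0: \<open>negbeta_digit \<beta> x i\<close> is the digit \<open>x\<^sub>i\<^sub>+\<^sub>1\<close>,
  the coefficient of \<open>(-\<beta>)\<close> to the power \<open>-(i + 1)\<close>.\<close>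

definition negbeta_digit :: "real \<Rightarrow> real \<Rightarrow> nat \<Rightarrow> int" where
  "negbeta_digit \<beta> x i = \<lfloor>- \<beta> * (negbeta_T \<beta> ^^ i) x - ell \<beta>\<rfloor>"

text \<open>For \<open>\<beta> > 1\<close> the minimum exists, since \<open>ell \<beta> < 0 < ell \<beta> + 1\<close>. The interval is open on
  both sides here.\<close>

definition negbeta_shift :: "real \<Rightarrow> real \<Rightarrow> nat" where
  "negbeta_shift \<beta> x = (LEAST k. x / (- \<beta>) ^ k \<in> {ell \<beta><..<ell \<beta> + 1})"

text \<open>An expansion is a pair of the digits before the radix point (a list, most significant
  digit first) and the digits after it (a sequence).\<close>

definition negbeta_expansion :: "real \<Rightarrow> real \<Rightarrow> int list \<times> (nat \<Rightarrow> int)" where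
  "negbeta_expansion \<beta> x =
     (let k = negbeta_shift \<beta> x; d = negbeta_digit \<beta> (x / (- \<beta>) ^ k)
      in (if k = 0 then [0] else map d [0..<k], \<lambda>i. d (k + i)))"

text \<open>The part before the radix point is a list, so only the fractional digits matter for
  finiteness.\<close>

definition finite_negbeta_expansion :: "real \<Rightarrow> real \<Rightarrow> bool" where
  "finite_negbeta_expansion \<beta> x \<longleftrightarrow> finite {i. snd (negbeta_expansion \<beta> x) i \<noteq> 0}"

definition int_adjoin :: "real \<Rightarrow> real set" where
  "int_adjoin a = range (\<lambda>q :: int poly. poly (map_poly of_int q) a)"

definition property_neg_F :: "real \<Rightarrow> bool" where
  "property_neg_F \<beta> \<longleftrightarrow> (\<forall>x \<in> int_adjoin (inverse \<beta>). finite_negbeta_expansion \<beta> x)"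

end

theory Submission
  imports Defs
begin

text \<open>Since \<open>\<beta> > 1\<close>, the point \<open>-1 / (\<beta> + 1)\<close> lies in the interior of the interval and is a fixed
  point of the transformation with digit \<open>1\<close>, so its expansion is \<open>0\<bullet>111\<dots>\<close>. It therefore suffices
  that \<open>1 / (\<beta> + 1) = ell \<beta> + 1\<close> belongs to \<open>\<int>[\<beta>\<^sup>-\<^sup>1]\<close>. If the orbit of \<open>ell \<beta>\<close> reaches \<open>0\<close>, this
  follows by running the orbit backwards. If \<open>p(\<beta>) = 0\<close> with \<open>p(-1) = \<plusminus>1\<close>, division by \<open>X + 1\<close> gives
  \<open>1 / (\<beta> + 1) = \<plusminus>q(\<beta>)\<close> with \<open>q \<in> \<int>[X]\<close>, so \<open>\<beta>\<^sup>-\<^sup>n / (\<beta> + 1) \<in> \<int>[\<beta>\<^sup>-\<^sup>1]\<close> for some \<open>n\<close>, and the factor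
  \<open>\<beta>\<^sup>-\<^sup>n\<close> is removed by means of \<open>y = \<beta>\<^sup>-\<^sup>1 - \<beta>\<^sup>-\<^sup>1 y\<close> for \<open>y = 1 / (\<beta> + 1)\<close>.\<close>

lemma map_poly_of_int_add:
  "map_poly of_int (p + q) = (map_poly of_int p + map_poly of_int q :: 'a :: ring_1 poly)"
  by (rule poly_eqI) (simp add: coeff_map_poly)

lemma map_poly_of_int_mult:
  "map_poly of_int (p * q) = (map_poly of_int p * map_poly of_int q :: 'a :: comm_ring_1 poly)"
  by (rule poly_eqI) (simp add: coeff_map_poly coeff_mult)

lemma of_int_in_int_adjoin: "of_int n \<in> int_adjoin a"
  unfolding int_adjoin_def by (rule range_eqI[of _ _ "[:n:]"]) (simp add: map_poly_pCons)

lemma generator_in_int_adjoin: "a \<in> int_adjoin a"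
  unfolding int_adjoin_def by (rule range_eqI[of _ _ "[:0, 1:]"]) (simp add: map_poly_pCons)

text \<open>\<open>int_adjoin a\<close> is the image of evaluation at \<open>a\<close>, which the
  two \<open>map_poly\<close> identities make a ring homomorphism on integer polynomials.\<close>

lemma int_adjoin_add: "x \<in> int_adjoin a \<Longrightarrow> y \<in> int_adjoin a \<Longrightarrow> x + y \<in> int_adjoin a"
  unfolding int_adjoin_def by (auto simp flip: map_poly_of_int_add poly_add)

lemma int_adjoin_mult: "x \<in> int_adjoin a \<Longrightarrow> y \<in> int_adjoin a \<Longrightarrow> x * y \<in> int_adjoin a"
  unfolding int_adjoin_def by (auto simp flip: map_poly_of_int_mult poly_mult)

lemma int_adjoin_uminus: "x \<in> int_adjoin a \<Longrightarrow> - x \<in> int_adjoin a"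
  using int_adjoin_mult[OF of_int_in_int_adjoin[of "-1"], of x a] by simp

lemma int_adjoin_diff: "x \<in> int_adjoin a \<Longrightarrow> y \<in> int_adjoin a \<Longrightarrow> x - y \<in> int_adjoin a"
  using int_adjoin_add[OF _ int_adjoin_uminus, of x a y] by simp

lemma int_adjoin_power: "x \<in> int_adjoin a \<Longrightarrow> x ^ n \<in> int_adjoin a"
  using of_int_in_int_adjoin[of 1] by (induction n) (auto intro: int_adjoin_mult)

text \<open>The degree of \<open>q\<close> serves as exponent. In the induction each new coefficient
  costs one more factor \<open>inverse \<beta>\<close>, which cancels the \<beta> that
  \<open>pCons\<close> puts in front of \<open>q\<close>.\<close>

lemma inverse_power_times_poly_in_int_adjoin:
  assumes "\<beta> \<noteq> 0"
  shows "\<exists>n. inverse \<beta> ^ n * poly (map_poly of_int q) \<beta> \<in> int_adjoin (inverse \<beta>)"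
proof (induction q)
  case 0
  then show ?case
    using of_int_in_int_adjoin[of 0] by simp
next
  case (pCons c q)
  then obtain n where n: "inverse \<beta> ^ n * poly (map_poly of_int q) \<beta> \<in> int_adjoin (inverse \<beta>)"
    by blast
  have "inverse \<beta> ^ Suc n * poly (map_poly of_int (pCons c q)) \<beta> =
      inverse \<beta> ^ Suc n * of_int c + inverse \<beta> ^ n * poly (map_poly of_int q) \<beta>"
    using assms by (simp add: map_poly_pCons algebra_simps)
  also have "\<dots> \<in> int_adjoin (inverse \<beta>)"
    by (intro int_adjoin_add int_adjoin_mult int_adjoin_power generator_in_int_adjoin
        of_int_in_int_adjoin n)
  finally show ?case by blast
qed

text \<open>Multiplied by \<open>inverse \<beta> ^ n\<close>, the identity for 1 / (\<beta> + 1)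
  expresses the element with exponent n through the one with exponent n + 1, so the exponent
  descends to 0.\<close>

lemma inverse_Suc_base_in_int_adjoin:
  assumes "\<beta> > 1" and n: "inverse \<beta> ^ n * (1 / (\<beta> + 1)) \<in> int_adjoin (inverse \<beta>)"
  shows "1 / (\<beta> + 1) \<in> int_adjoin (inverse \<beta>)"
  using n
proof (induction n)
  case (Suc n)
  have "\<beta> * (\<beta> + 1) > 0"
    using \<open>\<beta> > 1\<close> by simp
  then have "1 / (\<beta> + 1) = inverse \<beta> - inverse \<beta> * (1 / (\<beta> + 1))"
    using \<open>\<beta> > 1\<close> by (simp add: field_simps)
  then have "inverse \<beta> ^ n * (1 / (\<beta> + 1)) =
      inverse \<beta> ^ n * (inverse \<beta> - inverse \<beta> * (1 / (\<beta> + 1)))"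
    by (rule arg_cong)
  also have "\<dots> = inverse \<beta> ^ Suc n - inverse \<beta> ^ Suc n * (1 / (\<beta> + 1))"
    by (simp only: power_Suc algebra_simps)
  also have "\<dots> \<in> int_adjoin (inverse \<beta>)"
    by (intro int_adjoin_diff int_adjoin_power generator_in_int_adjoin Suc.prems)
  finally show ?case by (rule Suc.IH)
qed simp

text \<open>The floor is an integer d, and -\<beta> x - d can be solved for x by a single division
  by -\<beta>.\<close>

lemma negbeta_T_preimage_in_int_adjoin:
  assumes "\<beta> \<noteq> 0" and "negbeta_T \<beta> x \<in> int_adjoin (inverse \<beta>)"
  shows "x \<in> int_adjoin (inverse \<beta>)"
proof -
  have "x = - (inverse \<beta> * (negbeta_T \<beta> x + of_int \<lfloor>- \<beta> * x - ell \<beta>\<rfloor>))"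
    using \<open>\<beta> \<noteq> 0\<close> by (simp add: negbeta_T_def)
  then show ?thesis
    by (metis assms(2) generator_in_int_adjoin int_adjoin_add int_adjoin_mult int_adjoin_uminus
        of_int_in_int_adjoin)
qed

lemma negbeta_T_funpow_preimage_in_int_adjoin:
  assumes "\<beta> \<noteq> 0" and "(negbeta_T \<beta> ^^ k) x \<in> int_adjoin (inverse \<beta>)"
  shows "x \<in> int_adjoin (inverse \<beta>)"
  using assms(2) by (induction k) (auto dest: negbeta_T_preimage_in_int_adjoin[OF assms(1)])

lemma inverse_Suc_base_in_int_adjoin_if_root:
  fixes p :: "int poly"
  assumes "\<beta> > 1" and root: "poly (map_poly of_int p) \<beta> = 0" and unit: "\<bar>poly p (- 1)\<bar> = 1"
  shows "1 / (\<beta> + 1) \<in> int_adjoin (inverse \<beta>)"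
proof -
  define q where "q = synthetic_div p (- 1)"
  define c where "c = poly p (- 1)"
  \<comment> \<open>Division by X + 1 leaves the value at its root -1 as remainder.\<close>
  have "p = [:1, 1:] * q + [:c:]"
    using synthetic_div_correct'[of "- 1" p] by (simp add: q_def c_def)
  then have "map_poly real_of_int p = map_poly of_int [:1, 1:] * map_poly of_int q + map_poly of_int [:c:]"
    by (metis map_poly_of_int_add map_poly_of_int_mult)
  then have eq: "(\<beta> + 1) * poly (map_poly of_int q) \<beta> = - of_int c"
    using root by (simp add: map_poly_pCons algebra_simps)
  \<comment> \<open>Being its own inverse, c can be cleared by multiplying by -c, whichever sign it
    has.\<close>
  have "c * c = 1"
    using unit abs_mult_self_eq[of c] by (simp add: c_def)
  then have "real_of_int c * real_of_int c = 1"
    by (metis of_int_1 of_int_mult)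
  then have "(\<beta> + 1) * (- of_int c * poly (map_poly of_int q) \<beta>) = 1"
    using eq by (simp add: algebra_simps)
  then have inv: "1 / (\<beta> + 1) = - of_int c * poly (map_poly of_int q) \<beta>"
    using \<open>\<beta> > 1\<close> by (subst divide_eq_eq) (simp add: mult.commute)
  obtain n where n: "inverse \<beta> ^ n * poly (map_poly of_int q) \<beta> \<in> int_adjoin (inverse \<beta>)"
    using inverse_power_times_poly_in_int_adjoin[of \<beta> q] \<open>\<beta> > 1\<close> by auto
  have "inverse \<beta> ^ n * (1 / (\<beta> + 1)) =
      - (of_int c * (inverse \<beta> ^ n * poly (map_poly of_int q) \<beta>))"
    by (simp add: inv)
  also have "\<dots> \<in> int_adjoin (inverse \<beta>)"
    by (intro int_adjoin_uminus int_adjoin_mult of_int_in_int_adjoin n)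
  finally show ?thesis
    by (rule inverse_Suc_base_in_int_adjoin[OF \<open>\<beta> > 1\<close>])
qed

lemma floor_at_negbeta_fixed_point:
  assumes "\<beta> > 1"
  shows "\<lfloor>- \<beta> * (- 1 / (\<beta> + 1)) - ell \<beta>\<rfloor> = 1"
proof -
  have "- \<beta> * (- 1 / (\<beta> + 1)) - ell \<beta> = 2 * \<beta> / (\<beta> + 1)"
    by (simp add: ell_def flip: add_divide_distrib)
  \<comment> \<open>\<beta> > 1 gives \<beta> + 1 < 2 \<beta> < 2 (\<beta> + 1).\<close>
  moreover have "\<lfloor>2 * \<beta> / (\<beta> + 1)\<rfloor> = 1"
    using assms by (intro floor_unique) (simp_all add: field_simps)
  ultimately show ?thesis by simp
qed

lemma negbeta_T_fixed_point:
  assumes "\<beta> > 1"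
  shows "negbeta_T \<beta> (- 1 / (\<beta> + 1)) = - 1 / (\<beta> + 1)"
  unfolding negbeta_T_def floor_at_negbeta_fixed_point[OF assms]
  using assms by (simp add: field_simps)

lemma negbeta_digit_fixed_point:
  assumes "\<beta> > 1"
  shows "negbeta_digit \<beta> (- 1 / (\<beta> + 1)) i = 1"
proof -
  have "(negbeta_T \<beta> ^^ i) (- 1 / (\<beta> + 1)) = - 1 / (\<beta> + 1)"
    by (induction i) (simp_all add: negbeta_T_fixed_point[OF assms, simplified])
  then show ?thesis
    unfolding negbeta_digit_def by (simp only: floor_at_negbeta_fixed_point[OF assms])
qed

lemma negbeta_expansion_fixed_point_infinite:
  assumes "\<beta> > 1"
  shows "\<not> finite_negbeta_expansion \<beta> (- 1 / (\<beta> + 1))"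
proof -
  have "- 1 / (\<beta> + 1) \<in> {ell \<beta><..<ell \<beta> + 1}"
    using assms by (simp add: ell_def field_simps)
  \<comment> \<open>k = 0 already meets the condition, so every digit of the constant sequence is
    fractional.\<close>
  then have "negbeta_shift \<beta> (- 1 / (\<beta> + 1)) = 0"
    unfolding negbeta_shift_def by (intro Least_eq_0) simp
  then have "snd (negbeta_expansion \<beta> (- 1 / (\<beta> + 1))) i = 1" for i
    using negbeta_digit_fixed_point[OF assms, of i] by (simp add: negbeta_expansion_def)
  then show ?thesis
    by (simp add: finite_negbeta_expansion_def)
qed

theorem theorem1:
  fixes \<beta> :: real
  assumes "\<beta> > 1"
    and "(\<exists>k::nat. k \<ge> 1 \<and> (negbeta_T \<beta> ^^ k) (ell \<beta>) = 0) \<or>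
         (\<exists>p :: int poly. poly (map_poly of_int p) \<beta> = 0 \<and> \<bar>poly p (- 1)\<bar> = 1)"
  shows "\<not> property_neg_F \<beta>"
proof -
  have "1 / (\<beta> + 1) \<in> int_adjoin (inverse \<beta>)"
    using assms(2)
  proof (elim disjE exE conjE)
    fix k assume "(negbeta_T \<beta> ^^ k) (ell \<beta>) = 0"
    then have "ell \<beta> \<in> int_adjoin (inverse \<beta>)"
      using negbeta_T_funpow_preimage_in_int_adjoin[of \<beta> k "ell \<beta>"] \<open>\<beta> > 1\<close>
        of_int_in_int_adjoin[of 0] by simp
    then have "ell \<beta> + of_int 1 \<in> int_adjoin (inverse \<beta>)"
      by (intro int_adjoin_add of_int_in_int_adjoin)
    moreover have "ell \<beta> + of_int 1 = 1 / (\<beta> + 1)"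
      using \<open>\<beta> > 1\<close> by (simp add: ell_def field_simps)
    ultimately show ?thesis by simp
  next
    fix p :: "int poly"
    assume "poly (map_poly of_int p) \<beta> = 0" and "\<bar>poly p (- 1)\<bar> = 1"
    then show ?thesis
      by (rule inverse_Suc_base_in_int_adjoin_if_root[OF \<open>\<beta> > 1\<close>])
  qed
  then have "- 1 / (\<beta> + 1) \<in> int_adjoin (inverse \<beta>)"
    using int_adjoin_uminus[of "1 / (\<beta> + 1)"] by simp
  then show ?thesis
    using negbeta_expansion_fixed_point_infinite[OF \<open>\<beta> > 1\<close>] by (auto simp: property_neg_F_def)
qed

end
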